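(* Let $X,Y$ be topological spaces where $Y$ is Hausdorff. Let $g:X\to Y$ be a continuous map. If $(X,Y;g)$ has the coincidence property, then \[2\leq\mathrm{TC}_g(\pi_{2,1}^Y)\leq\min\{\mathrm{TC}(\pi_{2,1}^Y),\ 2\,\mathrm{TC}(F(Y,2))\}.\]
   Context: Maps are continuous. For a map $g:X\to Y$, the triple $(X,Y;g)$ has the coincidence property (CP) if for every map $f:X\to Y$ there is a point $x\in X$ with $f(x)=g(x)$. $F(Y,2)=\{(y_1,y_2)\in Y^2\mid y_1\neq y_2\}$ with the subspace topology from $Y^2$, and $\pi_{2,1}^Y:F(Y,2)\to Y$ is $\pi_{2,1}^Y(y_1,y_2)=y_1$. The sectional number $\mathrm{sec}(f)$ of a map $f:A\to B$ is the minimal cardinality of open covers of $B$ such that for each element $U$ of the cover there is a map $s:U\to A$ with $f\circ s$ equal to the inclusion $U\hookrightarrow B$ (with value $\infty$ if no finite such cover exists). For maps $p:E\to B$ and $g:X\to B$, the relative sectional number is $\mathrm{sec}_g(p)=\mathrm{sec}(g^\ast(p))$, where $g^\ast(p):X\times_B E\to X$, $(x,e)\mapsto x$, and $X\times_B E=\{(x,e)\in X\times E: g(x)=p(e)\}$. For a space $Z$, $Z^{[0,1]}$ is the space of paths $[0,1]\to Z$ with the compact-open topology, and $e_2^Z:Z^{[0,1]}\to Z\times Z$ is $e_2^Z(\gamma)=(\gamma(0),\gamma(1))$. For a map $f:Z\to Y$, $e_f:Z^{[0,1]}\to Z\times Y$ is $e_f=(1_Z\times f)\circ e_2^Z$. The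 topological complexity of $f$ is $\mathrm{TC}(f)=\mathrm{sec}(e_f)$, and $\mathrm{TC}(Z)=\mathrm{TC}(1_Z)=\mathrm{sec}(e_2^Z)$. For maps $f:Z\to Y$ and $g:X\to Y$, the topological complexity of $f$ relative to $g$ is $\mathrm{TC}_g(f)=\mathrm{sec}_{1_Z\times g}(e_f)$, where $1_Z\times g:Z\times X\to Z\times Y$.
   Formalization: The formal theorem additionally assumes that F(Y,2) is nonempty, i.e. that Y has at least two points; for X and Y a single point the coincidence property holds but TC_g of the projection is 0, so the lower bound 2 fails. *)

theory Defs
  imports "HOL-Analysis.Analysis" "HOL-Library.Extended_Nat"
begin

definition coincidence_property :: "'a topology \<Rightarrow> 'b topology \<Rightarrow> ('a \<Rightarrow> 'b) \<Rightarrow> bool" where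
  "coincidence_property X Y g \<longleftrightarrow>
     (\<forall>f. continuous_map X Y f \<longrightarrow> (\<exists>x\<in>topspace X. f x = g x))"

definition config2 :: "'a topology \<Rightarrow> ('a \<times> 'a) topology" where
  "config2 Y = subtopology (prod_topology Y Y) {(y1, y2). y1 \<noteq> y2}"

definition config_proj :: "'a \<times> 'a \<Rightarrow> 'a" where
  "config_proj = (\<lambda>(y1, y2). y1)"

text \<open>Covers are sets of open sets and the infimum of the empty set in \<^typ>\<open>enat\<close> is \<open>\<infinity>\<close>.
  The empty space has the empty cover, so a map to the empty space has sectional number 0.\<close>

definition sectional_number :: "'a topology \<Rightarrow> 'b topology \<Rightarrow> ('a \<Rightarrow> 'b) \<Rightarrow> enat" where
  "sectional_number A B f =
     (INF \<U> \<in> {\<U>. finite \<U> \<and> \<Union>\<U> = topspace B \<and>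
                  (\<forall>U\<in>\<U>. openin B U \<and>
                     (\<exists>s. continuous_map (subtopology B U) A s \<and> (\<forall>b\<in>U. f (s b) = b)))}.
        enat (card \<U>))"

definition fibre_product ::
  "'x topology \<Rightarrow> 'e topology \<Rightarrow> ('x \<Rightarrow> 'b) \<Rightarrow> ('e \<Rightarrow> 'b) \<Rightarrow> ('x \<times> 'e) topology" where
  "fibre_product X E g p = subtopology (prod_topology X E) {(x, e). g x = p e}"

text \<open>\<open>sec_g(p)\<close> for \<open>p : E \<rightarrow> B\<close> and \<open>g : X \<rightarrow> B\<close>; the topology of \<open>B\<close> does not enter.\<close>

definition relative_sectional_number ::
  "'x topology \<Rightarrow> 'e topology \<Rightarrow> ('x \<Rightarrow> 'b) \<Rightarrow> ('e \<Rightarrow> 'b) \<Rightarrow> enat" where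
  "relative_sectional_number X E g p = sectional_number (fibre_product X E g p) X fst"

text \<open>A path is represented by the function on the reals that agrees with it on the unit interval
  and is \<^const>\<open>undefined\<close> elsewhere, so that distinct points of the path space are distinct paths.
  The topology on \<open>path_space\<close> is the compact-open one.\<close>

definition paths :: "'a topology \<Rightarrow> (real \<Rightarrow> 'a) set" where
  "paths Z = {\<gamma> \<in> extensional {0..1}. pathin Z \<gamma>}"

definition path_space :: "'a topology \<Rightarrow> (real \<Rightarrow> 'a) topology" where
  "path_space Z = topology_generated_by
     {{\<gamma> \<in> paths Z. \<gamma> ` K \<subseteq> U} | K U. compactin (top_of_set {0..1}) K \<and> openin Z U}"

lemma topspace_path_space: "topspace (path_space Z) = paths Z"
proof -
  have "\<exists>K U. paths Z = {\<gamma> \<in> paths Z. \<gamma> ` K \<subseteq> U} \<and>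
              compactin (top_of_set {0..1::real}) K \<and> openin Z U"
    by (rule exI[of _ "{}"]) auto
  then show ?thesis
    unfolding path_space_def topology_generated_by_topspace by blast
qed

definition path_ends :: "(real \<Rightarrow> 'a) \<Rightarrow> 'a \<times> 'a" where
  "path_ends \<gamma> = (\<gamma> 0, \<gamma> 1)"

definition path_ends_along :: "('z \<Rightarrow> 'y) \<Rightarrow> (real \<Rightarrow> 'z) \<Rightarrow> 'z \<times> 'y" where
  "path_ends_along f = map_prod id f \<circ> path_ends"

definition TC_map :: "'z topology \<Rightarrow> 'y topology \<Rightarrow> ('z \<Rightarrow> 'y) \<Rightarrow> enat" where
  "TC_map Z Y f = sectional_number (path_space Z) (prod_topology Z Y) (path_ends_along f)"

definition TC :: "'z topology \<Rightarrow> enat" where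
  "TC Z = TC_map Z Z id"

lemma TC_eq_sectional_number:
  "TC Z = sectional_number (path_space Z) (prod_topology Z Z) path_ends"
  by (simp add: TC_def TC_map_def path_ends_along_def prod.map_id0)

definition relative_TC :: "'z topology \<Rightarrow> 'x topology \<Rightarrow> ('x \<Rightarrow> 'y) \<Rightarrow> ('z \<Rightarrow> 'y) \<Rightarrow> enat" where
  "relative_TC Z X g f =
     relative_sectional_number (prod_topology Z X) (path_space Z) (map_prod id g) (path_ends_along f)"

end

theory Submission
  imports Defs
begin

text \<open>
  Lower bound: a global section would provide a motion in \<open>F(Y,2)\<close> from a fixed point \<open>z\<close> to a point
  of the form \<open>(g x, f x)\<close>, depending continuously on \<open>x\<close>; then \<open>f\<close> has no coincidence with \<open>g\<close>.

  Upper bounds: both come from pulling sections of an endpoint map back along maps into its base,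
  defined on the members of an open cover of \<open>F(Y,2) \<times> X\<close>. For the first bound, the cover is the
  whole space and the map is \<open>(z, x) \<mapsto> (z, g x)\<close>. For the second, fix \<open>a \<noteq> b\<close> in \<open>Y\<close>; the maps
  \<open>(z, x) \<mapsto> (z, (g x, a))\<close> and \<open>(z, x) \<mapsto> (z, (g x, b))\<close> are defined where \<open>g x \<noteq> a\<close> and
  where \<open>g x \<noteq> b\<close> respectively, and these sets are open as points of \<open>Y\<close> are closed.
\<close>

definition sectional_cover ::
  "'a topology \<Rightarrow> 'b topology \<Rightarrow> ('a \<Rightarrow> 'b) \<Rightarrow> 'b set set \<Rightarrow> bool" where
  "sectional_cover A B f \<U> \<longleftrightarrow> finite \<U> \<and> \<Union>\<U> = topspace B \<and>
     (\<forall>U\<in>\<U>. openin B U \<and>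
        (\<exists>s. continuous_map (subtopology B U) A s \<and> (\<forall>b\<in>U. f (s b) = b)))"

lemma sectional_number_eq:
  "sectional_number A B f = (INF \<U> \<in> {\<U>. sectional_cover A B f \<U>}. enat (card \<U>))"
  by (simp add: sectional_number_def sectional_cover_def)

lemma sectional_number_le_card:
  "sectional_cover A B f \<U> \<Longrightarrow> sectional_number A B f \<le> enat (card \<U>)"
  unfolding sectional_number_eq by (rule INF_lower) simp

lemma sectional_number_attained:
  \<comment> \<open>A finite value means that the set of admissible covers is nonempty, and a
    nonempty subset of the well-order \<open>enat\<close> contains its infimum. This turns bounds on
    the number into actual covers.\<close>
  assumes "sectional_number A B f \<noteq> \<infinity>"
  obtains \<U> where "sectional_cover A B f \<U>" "sectional_number A B f = enat (card \<U>)"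
proof -
  let ?S = "(\<lambda>\<U>. enat (card \<U>)) ` {\<U>. sectional_cover A B f \<U>}"
  have "?S \<noteq> {}"
    using assms unfolding sectional_number_eq by (metis Inf_empty top_enat_def)
  then have "Inf ?S \<in> ?S"
    by (metis all_not_in_conv wellorder_InfI)
  then show ?thesis
    using that unfolding sectional_number_eq by blast
qed

text \<open>Nonemptiness of the base excludes the empty cover, so a minimal cover has exactly one
  member, which must be the whole base.\<close>

lemma global_section_if_sectional_number_less_2:
  assumes "sectional_number A B f < 2" "topspace B \<noteq> {}"
  obtains s where "continuous_map B A s" "\<And>b. b \<in> topspace B \<Longrightarrow> f (s b) = b"
proof -
  obtain \<U> where \<U>: "sectional_cover A B f \<U>" "sectional_number A B f = enat (card \<U>)"
    using assms(1) by (metis sectional_number_attained enat_ord_simps(6))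
  then have "card \<U> < 2"
    using assms(1) by (simp add: numeral_eq_enat)
  moreover have "finite \<U>" "\<Union>\<U> = topspace B"
    using \<U>(1) by (auto simp: sectional_cover_def)
  moreover have "\<U> \<noteq> {}"
    using \<open>\<Union>\<U> = topspace B\<close> assms(2) by (metis Union_empty)
  ultimately have "card \<U> = 1"
    using card_gt_0_iff[of \<U>] by linarith
  then have "\<U> = {topspace B}"
    using \<open>\<Union>\<U> = topspace B\<close> by (auto simp: card_1_singleton_iff)
  then show ?thesis
    using \<U>(1) that by (auto simp: sectional_cover_def)
qed

lemma openin_preimage_on_open:
  assumes "openin X V" "continuous_map (subtopology X V) B h" "openin B U"
  shows "openin X {x \<in> V. h x \<in> U}"
proof -
  have "topspace (subtopology X V) = V"
    using assms(1) openin_subset by (metis topspace_subtopology_subset)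
  then have "openin (subtopology X V) {x \<in> V. h x \<in> U}"
    using openin_continuous_map_preimage[OF assms(2,3)] by metis
  then show ?thesis
    using assms(1) openin_trans_full by blast
qed

text \<open>If \<open>s\<close> is a section of \<open>f\<close> over \<open>U\<close>, then
  \<open>x \<mapsto> (x, s (h i x))\<close> is a section of the pullback over the part of
  \<open>V i\<close> that \<open>h i\<close> sends into \<open>U\<close>. The hypothesis
  \<open>compat\<close> is what puts these pairs into the fibre product. The base \<open>B\<close>
  of \<open>f\<close> may differ from the common target of \<open>g\<close> and \<open>p\<close>;
  this freedom serves the bound with factor 2.\<close>

lemma relative_sectional_number_le_mult:
  assumes "finite I"
    and V: "\<And>i. i \<in> I \<Longrightarrow> openin X (V i)" "(\<Union>i\<in>I. V i) = topspace X"
    and h: "\<And>i. i \<in> I \<Longrightarrow> continuous_map (subtopology X (V i)) B (h i)"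
    and compat: "\<And>i x e. \<lbrakk>i \<in> I; x \<in> V i; f e = h i x\<rbrakk> \<Longrightarrow> g x = p e"
  shows "relative_sectional_number X E g p \<le> enat (card I) * sectional_number E B f"
proof (cases "sectional_number E B f = \<infinity>")
  case True
  \<comment> \<open>In \<open>enat\<close>, 0 times \<infinity> is 0, so an empty \<open>I\<close>
    needs its own argument: then \<open>X\<close> is empty and the empty cover works.\<close>
  show ?thesis
  proof (cases "I = {}")
    case True
    then have "topspace X = {}"
      using V(2) by simp
    then have "sectional_cover (fibre_product X E g p) X fst {}"
      by (simp add: sectional_cover_def)
    then have "relative_sectional_number X E g p \<le> 0"
      unfolding relative_sectional_number_def zero_enat_def
      by (metis card.empty sectional_number_le_card)
    then show ?thesis
      by (metis zero_le order_trans)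
  next
    case False
    then have "card I \<noteq> 0"
      using \<open>finite I\<close> by simp
    then show ?thesis
      using \<open>sectional_number E B f = \<infinity>\<close> by (simp add: imult_is_infinity zero_enat_def)
  qed
next
  case False
  then obtain \<U> where \<U>: "sectional_cover E B f \<U>" "sectional_number E B f = enat (card \<U>)"
    by (metis sectional_number_attained)
  define W where "W = (\<lambda>(i, U). {x \<in> V i. h i x \<in> U})"
  have fin: "finite (I \<times> \<U>)"
    using \<open>finite I\<close> \<U>(1) by (simp add: sectional_cover_def)
  have "sectional_cover (fibre_product X E g p) X fst (W ` (I \<times> \<U>))"
    unfolding sectional_cover_def
  proof (intro conjI ballI)
    have "W iU \<subseteq> topspace X" if "iU \<in> I \<times> \<U>" for iU
      using that V(2) by (auto simp: W_def)
    moreover have "\<exists>iU \<in> I \<times> \<U>. x \<in> W iU" if x: "x \<in> topspace X" for x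
    proof -
      obtain i where i: "i \<in> I" "x \<in> V i"
        using x V(2) by blast
      have "h i x \<in> topspace B"
        using continuous_map_image_subset_topspace[OF h[OF i(1)]] i(2) x by auto
      then obtain U where "U \<in> \<U>" "h i x \<in> U"
        using \<U>(1) unfolding sectional_cover_def by blast
      with i show ?thesis
        by (auto simp: W_def)
    qed
    ultimately show "\<Union> (W ` (I \<times> \<U>)) = topspace X"
      by blast
  next
    fix T
    assume "T \<in> W ` (I \<times> \<U>)"
    then obtain i U where iU: "i \<in> I" "U \<in> \<U>" and T: "T = {x \<in> V i. h i x \<in> U}"
      by (auto simp: W_def)
    obtain s where "openin B U" and s: "continuous_map (subtopology B U) E s"
        "\<And>b. b \<in> U \<Longrightarrow> f (s b) = b"
      using \<U>(1) iU(2) by (auto simp: sectional_cover_def)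
    show "openin X T"
      unfolding T using V(1)[OF iU(1)] h[OF iU(1)] \<open>openin B U\<close> by (rule openin_preimage_on_open)
    have "continuous_map (subtopology X T) B (h i)"
      using h[OF iU(1)] by (rule continuous_map_from_subtopology_mono) (auto simp: T)
    then have "continuous_map (subtopology X T) (subtopology B U) (h i)"
      by (auto simp: continuous_map_in_subtopology T)
    then have "continuous_map (subtopology X T) E (s \<circ> h i)"
      using s(1) by (rule continuous_map_compose)
    then have "continuous_map (subtopology X T) (prod_topology X E) (\<lambda>x. (x, s (h i x)))"
      by (simp add: continuous_map_pairwise o_def continuous_map_from_subtopology)
    moreover have "g x = p (s (h i x))" if "x \<in> T" for x
      using that compat[OF iU(1)] s(2) by (simp add: T)
    ultimately have "continuous_map (subtopology X T) (fibre_product X E g p) (\<lambda>x. (x, s (h i x)))"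
      by (auto simp: fibre_product_def continuous_map_in_subtopology)
    then show "\<exists>s. continuous_map (subtopology X T) (fibre_product X E g p) s \<and>
        (\<forall>x\<in>T. fst (s x) = x)"
      by fastforce
  qed (use fin in auto)
  then have "relative_sectional_number X E g p \<le> enat (card (W ` (I \<times> \<U>)))"
    unfolding relative_sectional_number_def by (rule sectional_number_le_card)
  \<comment> \<open>Only an inequality, since different pairs may give the same set.\<close>
  also have "\<dots> \<le> enat (card I * card \<U>)"
    using card_image_le[OF fin, of W] by (simp add: card_cartesian_product)
  finally show ?thesis
    by (simp add: \<U>(2))
qed

text \<open>Evaluation at \<open>t\<close> pulls an open \<open>U\<close> back to the subbasic set
  of the compact-open topology with \<open>K = {t}\<close>.\<close>

lemma continuous_map_path_eval:
  assumes "t \<in> {0..1}"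
  shows "continuous_map (path_space Z) Z (\<lambda>\<gamma>. \<gamma> t)"
  unfolding continuous_map
proof (intro conjI allI impI)
  show "(\<lambda>\<gamma>. \<gamma> t) ` topspace (path_space Z) \<subseteq> topspace Z"
    using assms
    by (auto simp: topspace_path_space paths_def pathin_def continuous_map_def)
next
  fix U
  assume "openin Z U"
  have "compactin (top_of_set {0..1}) {t}"
    using assms by simp
  then have "openin (path_space Z) {\<gamma> \<in> paths Z. \<gamma> ` {t} \<subseteq> U}"
    unfolding path_space_def using \<open>openin Z U\<close> by (intro topology_generated_by_Basis) blast
  then show "openin (path_space Z) {\<gamma> \<in> topspace (path_space Z). \<gamma> t \<in> U}"
    by (simp add: topspace_path_space)
qed

text \<open>The motions start at a point of \<open>config2 Y\<close>. If there were none, the base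
  would be empty and the relative complexity would be 0.\<close>

lemma two_le_relative_TC_config_proj:
  assumes "topspace (config2 Y) \<noteq> {}" "coincidence_property X Y g"
  shows "2 \<le> relative_TC (config2 Y) X g config_proj"
proof (rule ccontr)
  let ?F = "config2 Y"
  let ?P = "fibre_product (prod_topology ?F X) (path_space ?F) (map_prod id g)
      (path_ends_along config_proj)"
  assume "\<not> 2 \<le> relative_TC ?F X g config_proj"
  then have less: "sectional_number ?P (prod_topology ?F X) fst < 2"
    by (simp add: relative_TC_def relative_sectional_number_def)
  obtain z where z: "z \<in> topspace ?F"
    using assms(1) by blast
  \<comment> \<open>A constant map must also meet \<open>g\<close> somewhere, so \<open>X\<close> is
    nonempty and the section lemma applies.\<close>
  have "continuous_map X Y (\<lambda>x. fst z)"
    using z by (auto simp: config2_def)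
  then have "topspace X \<noteq> {}"
    using assms(2) unfolding coincidence_property_def by blast
  then have "topspace (prod_topology ?F X) \<noteq> {}"
    using z by auto
  with less obtain s where s: "continuous_map (prod_topology ?F X) ?P s"
      "\<And>b. b \<in> topspace (prod_topology ?F X) \<Longrightarrow> fst (s b) = b"
    using global_section_if_sectional_number_less_2 by blast
  \<comment> \<open>The endpoint of the motion chosen over \<open>(z, x)\<close>. Its second
    coordinate is the map tested against \<open>g\<close>.\<close>
  define c where "c = (\<lambda>x. snd (s (z, x)) 1)"
  have "continuous_map X (prod_topology ?F X) (\<lambda>x. (z, x))"
    using z by (simp add: continuous_map_pairwise o_def)
  then have sz: "continuous_map X ?P (\<lambda>x. s (z, x))"
    using continuous_map_compose[OF _ s(1)] by (simp add: o_def)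
  then have "continuous_map X (path_space ?F) (\<lambda>x. snd (s (z, x)))"
    unfolding fibre_product_def
    by (auto simp: continuous_map_in_subtopology continuous_map_pairwise o_def)
  then have c: "continuous_map X ?F c"
    using continuous_map_compose[OF _ continuous_map_path_eval[of 1 ?F]]
    by (simp add: o_def c_def)
  then have "continuous_map X Y (\<lambda>x. snd (c x))"
    by (auto simp: config2_def continuous_map_in_subtopology continuous_map_pairwise o_def)
  then obtain x where x: "x \<in> topspace X" "snd (c x) = g x"
    using assms(2) unfolding coincidence_property_def by blast
  \<comment> \<open>The fibre product condition makes \<open>g x\<close> the first coordinate of
    \<open>c x\<close>, so a coincidence would put \<open>c x\<close> on the diagonal.\<close>
  have "s (z, x) \<in> topspace ?P"
    using continuous_map_image_subset_topspace[OF sz] x(1) by blast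
  moreover have "fst (s (z, x)) = (z, x)"
    using s(2) z x(1) by simp
  ultimately have "fst (c x) = g x"
    by (auto simp: fibre_product_def path_ends_along_def path_ends_def config_proj_def c_def
        split_beta)
  moreover have "c x \<in> topspace ?F"
    using continuous_map_image_subset_topspace[OF c] x(1) by blast
  ultimately show False
    using x(2) by (auto simp: config2_def)
qed

lemma relative_TC_le_TC_map:
  assumes "continuous_map X Y g"
  shows "relative_TC Z X g f \<le> TC_map Z Y f"
proof -
  \<comment> \<open>One index and the whole space as its \<open>V\<close>: this is the plain
    pullback of sections along \<open>map_prod id g\<close>.\<close>
  have "relative_TC Z X g f \<le> enat (card {()}) * TC_map Z Y f"
    unfolding relative_TC_def TC_map_def
  proof (rule relative_sectional_number_le_mult)
    show "continuous_map (subtopology (prod_topology Z X) (topspace (prod_topology Z X)))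
        (prod_topology Z Y) (map_prod id g)"
      using continuous_map_compose[OF continuous_map_snd assms]
      by (simp add: continuous_map_pairwise o_def continuous_map_fst split_beta map_prod_def
          del: topspace_prod_topology)
  qed (auto simp del: topspace_prod_topology)
  then show ?thesis
    by (simp flip: one_enat_def One_nat_def)
qed

lemma relative_TC_config_proj_le:
  assumes "t1_space Y" "topspace (config2 Y) \<noteq> {}" "continuous_map X Y g"
  shows "relative_TC (config2 Y) X g config_proj \<le> 2 * TC (config2 Y)"
proof -
  let ?F = "config2 Y"
  let ?B = "prod_topology ?F X"
  \<comment> \<open>The two coordinates of any point of \<open>config2 Y\<close>.\<close>
  obtain a b where ab: "a \<in> topspace Y" "b \<in> topspace Y" "a \<noteq> b"
    using assms(2) by (auto simp: config2_def)
  define V where "V = (\<lambda>y. {w \<in> topspace ?B. g (snd w) \<in> topspace Y - {y}})"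
  have g_snd: "continuous_map ?B Y (\<lambda>w. g (snd w))"
    using continuous_map_compose[OF continuous_map_snd assms(3)] by (simp add: o_def)
  have g_in: "g x \<in> topspace Y" if "x \<in> topspace X" for x
    using that assms(3) by (auto simp: continuous_map_def)
  have "relative_TC ?F X g config_proj \<le> enat (card {a, b}) * TC ?F"
    unfolding relative_TC_def TC_eq_sectional_number
  proof (rule relative_sectional_number_le_mult)
    fix y
    assume "y \<in> {a, b}"
    then have y: "y \<in> topspace Y"
      using ab by blast
    then have "openin Y (topspace Y - {y})"
      using assms(1) by (simp add: closedin_t1_singleton openin_diff)
    then show "openin ?B (V y)"
      unfolding V_def by (rule openin_continuous_map_preimage[OF g_snd])
    have "continuous_map (subtopology ?B (V y)) ?F fst"
      by (intro continuous_map_from_subtopology continuous_map_fst)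
    moreover have "continuous_map (subtopology ?B (V y)) ?F (\<lambda>w. (g (snd w), y))"
      using y continuous_map_from_subtopology[OF g_snd, of "V y"]
      by (auto simp: config2_def continuous_map_in_subtopology continuous_map_pairwise o_def V_def)
    ultimately show "continuous_map (subtopology ?B (V y)) (prod_topology ?F ?F)
        (\<lambda>w. (fst w, (g (snd w), y)))"
      by (simp add: continuous_map_pairwise o_def)
  next
    \<comment> \<open>No \<open>g x\<close> can equal both \<open>a\<close> and
      \<open>b\<close>.\<close>
    show "(\<Union>y\<in>{a, b}. V y) = topspace ?B"
      using ab(3) g_in by (auto simp: V_def)
  \<comment> \<open>Compatibility: a path ending at \<open>(g x, y)\<close> has an endpoint that
    \<open>config_proj\<close> sends to \<open>g x\<close>, whatever \<open>y\<close> is.\<close>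
  qed (auto simp: path_ends_along_def config_proj_def)
  then show ?thesis
    using ab(3) by (simp add: numeral_eq_enat numeral_2_eq_2)
qed

theorem proposition4p11:
  fixes X :: "'a topology" and Y :: "'b topology" and g :: "'a \<Rightarrow> 'b"
  assumes "Hausdorff_space Y"
    and "topspace (config2 Y) \<noteq> {}"
    and "continuous_map X Y g"
    and "coincidence_property X Y g"
  shows "2 \<le> relative_TC (config2 Y) X g config_proj \<and>
    relative_TC (config2 Y) X g config_proj
           \<le> min (TC_map (config2 Y) Y config_proj) (2 * TC (config2 Y))"
  using two_le_relative_TC_config_proj[OF assms(2,4)]
    relative_TC_le_TC_map[OF assms(3)]
    relative_TC_config_proj_le[OF Hausdorff_imp_t1_space[OF assms(1)] assms(2,3)]
  by simp

end
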